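(* Assume $f\in C^2(0,+\infty)$ is a convex function with $f(1)=0$ and that there exists $\alpha_s>0$ such that $x^2f''(x)>\alpha_s$ for all $0<x\le1$. Then there exists $\alpha>0$ such that $$\bigl(f'(y)-f'(x)\bigr)^2\ge\alpha\Bigl(\frac1x-\frac1y\Bigr)\Bigl(\frac{f(x)}{1-x}-\frac{f(y)}{1-y}\Bigr)$$ for all $0<x<1<y$. The assumptions are satisfied by $f$ with $f(1)=0$ and $f''(x)=x^p$, for $p\le-2$. *)

theory Defs
  imports "HOL-Analysis.Analysis"
begin

text \<open>
  For an open set S only: then \<^term>\<open>deriv f\<close> and \<^term>\<open>deriv (deriv f)\<close> depend on S only
  through the values of f on S, and the differentiability conditions guarantee that they are
  genuine derivatives on S.
\<close>

definition twice_differentiable_on :: "(real \<Rightarrow> real) \<Rightarrow> real set \<Rightarrow> bool" where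
  "twice_differentiable_on f S \<longleftrightarrow> f differentiable_on S \<and> deriv f differentiable_on S"

definition C2_on :: "(real \<Rightarrow> real) \<Rightarrow> real set \<Rightarrow> bool" where
  "C2_on f S \<longleftrightarrow> twice_differentiable_on f S \<and> continuous_on S (deriv (deriv f))"

text \<open>A function on the open half-line is a total function whose values outside
  \<^term>\<open>{0<..} :: real set\<close> are irrelevant.\<close>

definition admissible :: "(real \<Rightarrow> real) \<Rightarrow> bool" where
  "admissible f \<longleftrightarrow>
     C2_on f {0<..} \<and> convex_on {0<..} f \<and> f 1 = 0 \<and>
     (\<exists>\<alpha>\<^sub>s>0. \<forall>x. 0 < x \<and> x \<le> 1 \<longrightarrow> x\<^sup>2 * deriv (deriv f) x > \<alpha>\<^sub>s)"

definition power_example :: "real \<Rightarrow> (real \<Rightarrow> real) \<Rightarrow> bool" where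
  "power_example p f \<longleftrightarrow>
     twice_differentiable_on f {0<..} \<and> f 1 = 0 \<and> (\<forall>x>0. deriv (deriv f) x = x powr p)"

end

theory Submission
  imports Defs
begin

text \<open>
  The tangent lines of f at x and at y, evaluated at 1, show that the second factor on the right is
  at most f'(y) - f'(x). For the first factor, the condition on f'' extends by continuity from
  (0, 1] to (0, z] for some z > 1, so that f'(t) + a/t is nondecreasing on (0, z]; together with the
  monotonicity of f' beyond z this bounds f'(y) - f'(x) from below by a multiple of 1/x - 1/y.
  The product of the two bounds is the claim.
\<close>

lemma twice_differentiable_on_DERIV:
  assumes "twice_differentiable_on f S" "open S" "x \<in> S"
  shows "(f has_real_derivative deriv f x) (at x)"
    and "(deriv f has_real_derivative deriv (deriv f) x) (at x)"
  using assms unfolding twice_differentiable_on_def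
  by (metis DERIV_deriv_iff_real_differentiable at_within_open differentiable_on_def)+

lemma twice_differentiable_onI:
  assumes "open S"
    and f: "\<And>x. x \<in> S \<Longrightarrow> (f has_real_derivative f' x) (at x)"
    and f': "\<And>x. x \<in> S \<Longrightarrow> (f' has_real_derivative f'' x) (at x)"
  shows "twice_differentiable_on f S" and "\<And>x. x \<in> S \<Longrightarrow> deriv (deriv f) x = f'' x"
proof -
  \<comment> \<open>\<open>deriv f\<close> is known to equal \<open>f'\<close> only on
    \<open>S\<close>; since \<open>S\<close> is open, they agree near \<open>x\<close>, so the
    derivative carries over.\<close>
  have df: "(deriv f has_real_derivative f'' x) (at x)" if "x \<in> S" for x
    by (rule has_field_derivative_transform_within_open[OF f'[OF that] \<open>open S\<close> that])
      (metis f DERIV_imp_deriv)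
  show "twice_differentiable_on f S"
    unfolding twice_differentiable_on_def differentiable_on_def
    using f df by (meson differentiable_at_withinI real_differentiable_def)
  show "deriv (deriv f) x = f'' x" if "x \<in> S" for x
    using df[OF that] by (rule DERIV_imp_deriv)
qed

lemma admissible_deriv_diff_ge:
  assumes "admissible f"
  shows "\<exists>\<alpha>>0. \<forall>x y. 0 < x \<and> x < 1 \<and> 1 < y \<longrightarrow>
           \<alpha> * (1 / x - 1 / y) \<le> deriv f y - deriv f x"
proof -
  from assms obtain a where tw: "twice_differentiable_on f {0<..}"
    and cont: "continuous_on {0<..} (deriv (deriv f))" and conv: "convex_on {0<..} f"
    and a: "a > 0" "\<And>x. 0 < x \<Longrightarrow> x \<le> 1 \<Longrightarrow> x\<^sup>2 * deriv (deriv f) x > a"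
    unfolding admissible_def C2_on_def by blast
  note D = twice_differentiable_on_DERIV[OF tw open_greaterThan, unfolded greaterThan_iff]
  have mono: "deriv f x \<le> deriv f y" if "0 < x" "x \<le> y" for x y
  proof (cases "x = y")
    case False
    \<comment> \<open>Adding the tangent inequalities at \<open>x\<close> and at \<open>y\<close>
      cancels the values of \<open>f\<close> and leaves the monotonicity of
      \<open>deriv f\<close>.\<close>
    have above: "deriv f u * (v - u) \<le> f v - f u" if "u > 0" "v > 0" for u v
      using that by (intro convex_on_imp_above_tangent[OF conv])
        (auto simp: interior_open D(1) has_field_derivative_at_within)
    have "0 \<le> (deriv f y - deriv f x) * (y - x)"
      using above[of x y] above[of y x] that by (simp add: algebra_simps)
    then show ?thesis
      using that False by (simp add: zero_le_mult_iff)
  qed simp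
  have "continuous_on {0<..} (\<lambda>x. x\<^sup>2 * deriv (deriv f) x)"
    using cont by (intro continuous_intros)
  then have "isCont (\<lambda>x. x\<^sup>2 * deriv (deriv f) x) 1"
    by (simp add: continuous_on_eq_continuous_at)
  \<comment> \<open>The inequality is strict at 1, so it persists nearby. The filter
    \<open>at 1\<close> omits the point 1 itself, which \<open>a(2)\<close> covers.\<close>
  then have "\<forall>\<^sub>F x in at 1. x\<^sup>2 * deriv (deriv f) x > a"
    using a(2)[of 1] by (auto simp: isCont_def intro: order_tendstoD)
  then obtain d where d: "d > 0"
    "\<And>x. x \<noteq> 1 \<Longrightarrow> dist x 1 < d \<Longrightarrow> x\<^sup>2 * deriv (deriv f) x > a"
    by (auto simp: eventually_at)
  \<comment> \<open>Halving \<open>d\<close> puts all of (1, z], endpoint included, strictly within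
    distance \<open>d\<close> of 1.\<close>
  define z where "z = 1 + d / 2"
  have z: "z > 1"
    using d(1) by (simp add: z_def)
  have f2: "x\<^sup>2 * deriv (deriv f) x > a" if "0 < x" "x \<le> z" for x
    using a(2)[of x] d(2)[of x] d(1) that by (cases "x \<le> 1") (auto simp: z_def dist_real_def)
  have low: "a * (1 / x - 1 / y) \<le> deriv f y - deriv f x" if "0 < x" "x \<le> y" "y \<le> z" for x y
  proof -
    have "deriv f x + a / x \<le> deriv f y + a / y"
    proof (rule DERIV_nonneg_imp_nondecreasing[OF \<open>x \<le> y\<close>])
      fix t assume t: "x \<le> t" "t \<le> y"
      with that have "0 < t" "t \<le> z" by auto
      then have "((\<lambda>t. deriv f t + a / t) has_real_derivative deriv (deriv f) t - a / t\<^sup>2) (at t)"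
        by (auto intro!: derivative_eq_intros D(2) simp: power2_eq_square)
      moreover have "deriv (deriv f) t - a / t\<^sup>2 \<ge> 0"
        using f2[of t] \<open>0 < t\<close> \<open>t \<le> z\<close> by (simp add: field_simps)
      ultimately show "\<exists>l. ((\<lambda>t. deriv f t + a / t) has_real_derivative l) (at t) \<and> l \<ge> 0"
        by blast
    qed
    then show ?thesis by (simp add: algebra_simps)
  qed
  show ?thesis
  \<comment> \<open>For y \<le> z the constant \<open>a\<close> would do, and the factor 1 - 1/z < 1
    only weakens it. For y > z the bound is available only up to \<open>z\<close>, and the factor
    pays for this: as x < 1, (1 - 1/z)/x = 1/x - 1/(xz) \<le> 1/x - 1/z.\<close>
  proof (intro exI[of _ "a * (1 - 1 / z)"] conjI allI impI)
    show "a * (1 - 1 / z) > 0" using a(1) z by simp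
    fix x y :: real assume xy: "0 < x \<and> x < 1 \<and> 1 < y"
    show "a * (1 - 1 / z) * (1 / x - 1 / y) \<le> deriv f y - deriv f x"
    proof (cases "y \<le> z")
      case True
      have "a * (1 - 1 / z) * (1 / x - 1 / y) \<le> a * 1 * (1 / x - 1 / y)"
        using a(1) z xy by (intro mult_right_mono mult_left_mono) (auto simp: frac_le)
      then show ?thesis using low[of x y] True xy by simp
    next
      case False
      have "(1 - 1 / z) * (1 / x - 1 / y) \<le> (1 - 1 / z) * (1 / x)"
        using z xy by (intro mult_left_mono) auto
      also have "\<dots> \<le> 1 / x - 1 / z"
        using z xy by (simp add: field_simps)
      finally have "a * (1 - 1 / z) * (1 / x - 1 / y) \<le> a * (1 / x - 1 / z)"
        using a(1) by (simp add: mult.assoc)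
      also have "\<dots> \<le> deriv f z - deriv f x" using low[of x z] xy z by simp
      also have "\<dots> \<le> deriv f y - deriv f x" using mono[of z y] z False by simp
      finally show ?thesis .
    qed
  qed
qed

lemma admissible_deriv_diff_ge_quotients:
  assumes "admissible f" "0 < x" "x < 1" "1 < y"
  shows "f x / (1 - x) - f y / (1 - y) \<le> deriv f y - deriv f x"
proof -
  from assms have tw: "twice_differentiable_on f {0<..}" and conv: "convex_on {0<..} f"
    and f1: "f 1 = 0"
    by (auto simp: admissible_def C2_on_def)
  have tangent: "deriv f u * (1 - u) \<le> - f u" if "u > 0" for u
  proof -
    have "deriv f u * (1 - u) \<le> f 1 - f u"
      using that twice_differentiable_on_DERIV(1)[OF tw open_greaterThan]
      by (intro convex_on_imp_above_tangent[OF conv])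
        (auto simp: interior_open has_field_derivative_at_within)
    then show ?thesis by (simp add: f1)
  qed
  \<comment> \<open>Division by 1 - u keeps the direction of \<open>tangent\<close> at
    \<open>x\<close> and reverses it at \<open>y\<close>, so the two bounds add up.\<close>
  have "f x / (1 - x) \<le> - deriv f x"
    using tangent[of x] assms by (simp add: field_simps)
  moreover have "- f y / (1 - y) \<le> deriv f y"
    using tangent[of y] assms by (simp add: field_simps)
  ultimately show ?thesis by simp
qed

text \<open>Keeps the claim about the power examples from being vacuous. Integrating
  \<open>x powr p\<close> twice gives a witness; at p = -2 the second integration produces a
  logarithm.\<close>

lemma power_example_exists: "\<exists>f. power_example p f" if "p \<le> - 2"
proof (cases "p = - 2")
  case True
  have "((\<lambda>x. - ln x) has_real_derivative - (1 / x)) (at x)"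
    "((\<lambda>x. - (1 / x)) has_real_derivative x powr p) (at x)" if "x \<in> {0<..}" for x
    using that by (auto intro!: derivative_eq_intros
        simp: True powr_minus power2_eq_square field_simps)
  from twice_differentiable_onI[OF open_greaterThan this]
  show ?thesis
    by (auto simp: power_example_def intro!: exI[of _ "\<lambda>x. - ln x"])
next
  case False
  \<comment> \<open>The linear term is taken to be zero and the constant term is fixed by f(1) =
    0.\<close>
  let ?f = "\<lambda>x::real. (x powr (p + 2) - 1) / ((p + 1) * (p + 2))"
  have p: "p + 1 \<noteq> 0" "p + 2 \<noteq> 0" using that False by auto
  have "(?f has_real_derivative x powr (p + 1) / (p + 1)) (at x)"
    "((\<lambda>x. x powr (p + 1) / (p + 1)) has_real_derivative x powr p) (at x)"
    if "x \<in> {0<..}" for x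
  proof -
    have "((\<lambda>x. x powr (p + 2)) has_real_derivative (p + 2) * x powr (p + 1)) (at x)"
      using has_real_derivative_powr[of x "p + 2"] that by (simp add: algebra_simps)
    from DERIV_cdivide[OF DERIV_diff[OF this DERIV_const[of 1]], of "(p + 1) * (p + 2)"]
    show "(?f has_real_derivative x powr (p + 1) / (p + 1)) (at x)"
      using p by simp
    have "((\<lambda>x. x powr (p + 1)) has_real_derivative (p + 1) * x powr p) (at x)"
      using has_real_derivative_powr[of x "p + 1"] that by simp
    from DERIV_cdivide[OF this, of "p + 1"]
    show "((\<lambda>x. x powr (p + 1) / (p + 1)) has_real_derivative x powr p) (at x)"
      using p by simp
  qed
  from twice_differentiable_onI[OF open_greaterThan this]
  show ?thesis
    by (auto simp: power_example_def intro!: exI[of _ ?f])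
qed

lemma power_example_imp_admissible:
  assumes p: "p \<le> - 2" and f: "power_example p f"
  shows "admissible f"
proof -
  from f have tw: "twice_differentiable_on f {0<..}" and f1: "f 1 = 0"
    and f2: "\<And>x. x > 0 \<Longrightarrow> deriv (deriv f) x = x powr p"
    by (auto simp: power_example_def)
  note D = twice_differentiable_on_DERIV[OF tw open_greaterThan]
  have "continuous_on {0<..} (\<lambda>x::real. x powr p)"
    by (intro continuous_intros) auto
  then have "continuous_on {0<..} (deriv (deriv f))"
    by (rule continuous_on_eq) (simp add: f2)
  moreover have "convex_on {0<..} f"
    by (rule f''_ge0_imp_convex[OF _ D]) (auto simp: f2)
  \<comment> \<open>Since p + 2 \<le> 0, the left side \<open>x powr (p + 2)\<close> is at least 1
    on (0, 1], with equality at 1. The strict inequality therefore calls for a constant below 1,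
    such as 1/2.\<close>
  moreover have "x\<^sup>2 * deriv (deriv f) x > 1 / 2" if "0 < x" "x \<le> 1" for x
  proof -
    have "x\<^sup>2 * deriv (deriv f) x = x powr (p + 2)"
      using that by (simp add: f2 powr_add powr_numeral)
    moreover have "x powr 0 \<le> x powr (p + 2)"
      using that p by (intro powr_mono') auto
    ultimately show ?thesis using that by simp
  qed
  ultimately show ?thesis
    using tw f1 unfolding admissible_def C2_on_def
    by (metis half_gt_zero zero_less_one)
qed

theorem proposition4p7:
  "(\<forall>f :: real \<Rightarrow> real. admissible f \<longrightarrow>
      (\<exists>\<alpha>>0. \<forall>x y. 0 < x \<and> x < 1 \<and> 1 < y \<longrightarrow>
        (deriv f y - deriv f x)\<^sup>2
          \<ge> \<alpha> * (1 / x - 1 / y) * (f x / (1 - x) - f y / (1 - y)))) \<and>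
   (\<forall>p :: real. p \<le> - 2 \<longrightarrow>
      (\<exists>f. power_example p f) \<and> (\<forall>f. power_example p f \<longrightarrow> admissible f))"
proof (intro conjI allI impI)
  fix f :: "real \<Rightarrow> real" assume f: "admissible f"
  obtain \<alpha> where \<alpha>: "\<alpha> > 0"
    "\<And>x y. 0 < x \<and> x < 1 \<and> 1 < y \<Longrightarrow> \<alpha> * (1 / x - 1 / y) \<le> deriv f y - deriv f x"
    using admissible_deriv_diff_ge[OF f] by blast
  show "\<exists>\<alpha>>0. \<forall>x y. 0 < x \<and> x < 1 \<and> 1 < y \<longrightarrow>
    \<alpha> * (1 / x - 1 / y) * (f x / (1 - x) - f y / (1 - y)) \<le> (deriv f y - deriv f x)\<^sup>2"
  proof (intro exI[of _ \<alpha>] conjI allI impI \<alpha>(1))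
    fix x y :: real assume xy: "0 < x \<and> x < 1 \<and> 1 < y"
    let ?D = "deriv f y - deriv f x"
    \<comment> \<open>Used twice: it allows multiplying the bound on the quotients by this factor,
      and together with \<open>\<alpha>(2)\<close> it gives \<open>?D\<close> \<ge> 0, which allows
      the final multiplication by \<open>?D\<close>.\<close>
    have pos: "0 \<le> \<alpha> * (1 / x - 1 / y)"
      using \<alpha>(1) xy by (simp add: frac_le)
    have "\<alpha> * (1 / x - 1 / y) * (f x / (1 - x) - f y / (1 - y)) \<le> \<alpha> * (1 / x - 1 / y) * ?D"
      using admissible_deriv_diff_ge_quotients[OF f] xy pos by (intro mult_left_mono) auto
    also have "\<dots> \<le> ?D * ?D"
      using \<alpha>(2)[OF xy] pos by (intro mult_right_mono) auto
    finally show "\<alpha> * (1 / x - 1 / y) * (f x / (1 - x) - f y / (1 - y)) \<le> ?D\<^sup>2"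
      by (simp add: power2_eq_square)
  qed
qed (use power_example_exists power_example_imp_admissible in blast)+

end
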